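(* Let $\mathcal{A}$ be an algorithm for the backward MAMP problem, and let $\mathrm{SA}(\mathcal{A})$ be the simultaneous-arrival algorithm that uses $\mathcal{A}$ to solve the backward problem (all defined in the context). If $\mathcal{A}$ is complete for the backward MAMP problem, then $\mathrm{SA}(\mathcal{A})$ is complete for the MAMP problem with simultaneous arrival (for instances in which all agents are at rest at their initial states).
   Context: **Instance.** There are $K\ge 1$ agents in a workspace $W\subset\mathbb{R}^2$ with obstacle region $O\subset W$. Agent $i$ has dynamics $\dot x_i(t)=f_i(x_i(t),u_i(t))$, control set $\mathcal{U}_i\subset\mathbb{R}^{m_i}$, and occupies the region $R_i(x_i)\subset\mathbb{R}^2$ when in state $x_i\in\mathbb{R}^{n_i}$. Its state space is $\mathcal{X}_i=\{x_i\in\mathbb{R}^{n_i} : R_i(x_i)\subset W\}$ and its free space is $\mathcal{X}_{i,\mathrm{free}}=\{x_i\in\mathcal{X}_i : R_i(x_i)\cap O=\emptyset\}$. Each agent has an initial state $x_{s,i}$ and a final state $x_{f,i}$. All agents are at rest at their initial states: $\mathbf 0\in\mathcal{U}_i$ and $f_i(x_{s,i},\mathbf 0)=0$, so agent $i$ can remain ("wait") at $x_{s,i}$ with control $\mathbf 0$ for any duration. **Motion primitives.** A set $\mathcal{P}$ of feasible motion primitives is given for each agent: each primitive is a pair $(x,u)$ of functions on an interval $[0,t_p]$ satisfying the agent's dynamics with controls in $\mathcal{U}_i$ (all translated copies that may be used are included in the set). An admissible forward trajectory of agent $i$ of duration $T\ge 0$ is a wait at $x_{s,i}$ of some duration $\tau\ge0$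 followed by a finite (possibly empty) concatenation of primitives with matching endpoint states, of total duration $T$. **MAMP problem with simultaneous arrival.** A feasible solution consists of a common final time $t_f\ge 0$ and, for each $i$, an admissible forward trajectory $(x_i,u_i)$ on $[0,t_f]$ with $x_i(0)=x_{s,i}$, $x_i(t_f)=x_{f,i}$, $x_i(t)\in\mathcal{X}_{i,\mathrm{free}}$ for all $t\in[0,t_f]$, and $R_i(x_i(t))\cap R_j(x_j(t))=\emptyset$ for all $i\ne j$ and $t\in[0,t_f]$. **Backward MAMP problem.** Here the initial states are $x_{f,i}$, the final states are $x_{s,i}$, and the primitives are the time reversals of the primitives in $\mathcal{P}$. A feasible solution consists, for each $i$, of a duration $t_{f,i}\ge0$ (not necessarily equal for different agents) and a pair $(x_{\mathrm{rev},i},u_{\mathrm{rev},i})$ on $[0,t_{f,i}]$ that is the time reversal $t\mapsto (x_i(t_{f,i}-t),u_i(t_{f,i}-t))$ of an admissible forward trajectory of duration $t_{f,i}$, with $x_{\mathrm{rev},i}(0)=x_{f,i}$, $x_{\mathrm{rev},i}(t_{f,i})=x_{s,i}$ and $x_{\mathrm{rev},i}(t)\in\mathcal{X}_{i,\mathrm{free}}$. After time $t_{f,i}$ agent $i$ remains at $x_{s,i}$, i.e. $x_{\mathrm{rev},i}(t)=x_{s,i}$ for $t>t_{f,i}$, and with this extension $R_i(x_{\mathrm{rev},i}(t))\cap R_j(x_{\mathrm{rev},j}(t))=\emptyset$ for all $i\neq j$ and all $t\ge0$. **Algorithm $\mathrm{SA}(\mathcal{A})$.** Given an instance: (1) run $\mathcal{A}$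 on the backward MAMP problem to obtain $\{(x_{\mathrm{rev},i},u_{\mathrm{rev},i},t_{f,i})\}_{i=1}^K$; (2) set $t_f=\max_i t_{f,i}$; (3) for each $i$ and $t\in[0,t_f]$, set $x_i(t)=x_{\mathrm{rev},i}(t_f-t)$ and $u_i(t)=u_{\mathrm{rev},i}(t_f-t)$ if $t\ge t_f-t_{f,i}$, and $x_i(t)=x_{s,i}$, $u_i(t)=\mathbf 0$ otherwise; (4) return $(x_i,u_i)_{i=1}^K$ and $t_f$. **Completeness.** An algorithm for a problem is complete if, for every instance that has a feasible solution, it terminates and returns a feasible solution. (Since feasible solutions are built from the given primitives, this is completeness in the "resolution" sense.) *)

theory Defs
  imports Complex_Main "Jordan_Normal_Form.Matrix"
begin

(* The dimensions n_i and m_i differ between agents and between instances, so states and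
   controls are dimension-carrying vectors: an element of R^n is v with v \<in> carrier_vec n.
   The plane R^2 is real \<times> real. *)

type_synonym point = "real \<times> real"

(* A pair of functions on [0, duration]. Values outside this interval have no meaning. *)
record motion =
  duration :: real
  state :: "real \<Rightarrow> real vec"
  control :: "real \<Rightarrow> real vec"

record agent =
  state_dim :: nat
  control_dim :: nat
  dynamics :: "real vec \<Rightarrow> real vec \<Rightarrow> real vec"
  controls :: "real vec set"
  region :: "real vec \<Rightarrow> point set"
  start :: "real vec"
  goal :: "real vec"
  primitives :: "motion set"

(* The agents are those with index i < num_agents. *)
record mamp =
  num_agents :: nat
  workspace :: "point set"
  obstacles :: "point set"
  agent :: "nat \<Rightarrow> agent"

definition state_space :: "mamp \<Rightarrow> nat \<Rightarrow> real vec set" where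
  "state_space I i =
     {x \<in> carrier_vec (state_dim (agent I i)). region (agent I i) x \<subseteq> workspace I}"

definition free_space :: "mamp \<Rightarrow> nat \<Rightarrow> real vec set" where
  "free_space I i = {x \<in> state_space I i. region (agent I i) x \<inter> obstacles I = {}}"

(* The differential equation is required componentwise at every time of the closed interval,
   with one-sided derivatives at its end points. *)
definition feasible_primitive :: "agent \<Rightarrow> motion \<Rightarrow> bool" where
  "feasible_primitive a p \<longleftrightarrow> 0 < duration p \<and>
     (\<forall>t \<in> {0..duration p}.
        state p t \<in> carrier_vec (state_dim a) \<and>
        control p t \<in> controls a \<and>
        (\<forall>k < state_dim a. ((\<lambda>s. state p s $ k) has_real_derivative
            dynamics a (state p t) (control p t) $ k) (at t within {0..duration p})))"

definition at_rest :: "agent \<Rightarrow> bool" where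
  "at_rest a \<longleftrightarrow> 0\<^sub>v (control_dim a) \<in> controls a \<and>
     dynamics a (start a) (0\<^sub>v (control_dim a)) = 0\<^sub>v (state_dim a)"

definition mamp_instance :: "mamp \<Rightarrow> bool" where
  "mamp_instance I \<longleftrightarrow> 1 \<le> num_agents I \<and> obstacles I \<subseteq> workspace I \<and>
     (\<forall>i < num_agents I. let a = agent I i in
        controls a \<subseteq> carrier_vec (control_dim a) \<and>
        (\<forall>x \<in> carrier_vec (state_dim a). \<forall>u \<in> controls a.
           dynamics a x u \<in> carrier_vec (state_dim a)) \<and>
        start a \<in> state_space I i \<and> goal a \<in> state_space I i \<and>
        at_rest a \<and>
        (\<forall>p \<in> primitives a. feasible_primitive a p))"

definition wait :: "agent \<Rightarrow> real \<Rightarrow> motion" where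
  "wait a \<tau> = \<lparr>duration = \<tau>, state = (\<lambda>_. start a), control = (\<lambda>_. 0\<^sub>v (control_dim a))\<rparr>"

(* Used only when the end state of m is the initial state of p. At the junction time the
   control is that of the later piece. *)
definition append_motion :: "motion \<Rightarrow> motion \<Rightarrow> motion" where
  "append_motion m p = \<lparr>duration = duration m + duration p,
     state = (\<lambda>t. if t < duration m then state m t else state p (t - duration m)),
     control = (\<lambda>t. if t < duration m then control m t else control p (t - duration m))\<rparr>"

inductive wait_then_primitives :: "agent \<Rightarrow> motion \<Rightarrow> bool" for a where
  wait: "0 \<le> \<tau> \<Longrightarrow> wait_then_primitives a (wait a \<tau>)"
| append: "wait_then_primitives a m \<Longrightarrow> p \<in> primitives a \<Longrightarrow> state m (duration m) = state p 0
    \<Longrightarrow> wait_then_primitives a (append_motion m p)"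

(* Equality of motions as functions on [0, duration]. *)
definition same_motion :: "motion \<Rightarrow> motion \<Rightarrow> bool" where
  "same_motion m m' \<longleftrightarrow> duration m = duration m' \<and>
     (\<forall>t \<in> {0..duration m}. state m t = state m' t \<and> control m t = control m' t)"

definition admissible_forward :: "agent \<Rightarrow> motion \<Rightarrow> bool" where
  "admissible_forward a m \<longleftrightarrow> (\<exists>m'. wait_then_primitives a m' \<and> same_motion m m')"

definition reverse_motion :: "motion \<Rightarrow> motion" where
  "reverse_motion m = \<lparr>duration = duration m,
     state = (\<lambda>t. state m (duration m - t)),
     control = (\<lambda>t. control m (duration m - t))\<rparr>"

definition feasible_solution :: "mamp \<Rightarrow> real \<times> (nat \<Rightarrow> motion) \<Rightarrow> bool" where
  "feasible_solution I sol \<longleftrightarrow> (case sol of (tf, m) \<Rightarrow>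
     0 \<le> tf \<and>
     (\<forall>i < num_agents I.
        duration (m i) = tf \<and>
        admissible_forward (agent I i) (m i) \<and>
        state (m i) 0 = start (agent I i) \<and>
        state (m i) tf = goal (agent I i) \<and>
        (\<forall>t \<in> {0..tf}. state (m i) t \<in> free_space I i)) \<and>
     (\<forall>i < num_agents I. \<forall>j < num_agents I. i \<noteq> j \<longrightarrow>
        (\<forall>t \<in> {0..tf}.
           region (agent I i) (state (m i) t) \<inter> region (agent I j) (state (m j) t) = {})))"

(* The data of the backward problem. Reversed primitives obey x' = - f(x, u). *)
definition backward_agent :: "agent \<Rightarrow> agent" where
  "backward_agent a = a\<lparr>dynamics := (\<lambda>x u. - dynamics a x u),
     start := goal a, goal := start a, primitives := reverse_motion ` primitives a\<rparr>"

definition backward :: "mamp \<Rightarrow> mamp" where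
  "backward I = I\<lparr>agent := (\<lambda>i. backward_agent (agent I i))\<rparr>"

(* A backward motion of agent a, extended beyond its duration by remaining at start a. *)
definition extended_state :: "agent \<Rightarrow> motion \<Rightarrow> real \<Rightarrow> real vec" where
  "extended_state a b t = (if t \<le> duration b then state b t else start a)"

(* Feasibility of b for the problem with data backward I, where start and goal are those
   of the forward instance I. *)
definition feasible_backward_solution :: "mamp \<Rightarrow> (nat \<Rightarrow> motion) \<Rightarrow> bool" where
  "feasible_backward_solution I b \<longleftrightarrow>
     (\<forall>i < num_agents I.
        0 \<le> duration (b i) \<and>
        (\<exists>m. admissible_forward (agent I i) m \<and> same_motion (b i) (reverse_motion m)) \<and>
        state (b i) 0 = goal (agent I i) \<and>
        state (b i) (duration (b i)) = start (agent I i) \<and>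
        (\<forall>t \<in> {0..duration (b i)}. state (b i) t \<in> free_space I i)) \<and>
     (\<forall>i < num_agents I. \<forall>j < num_agents I. i \<noteq> j \<longrightarrow>
        (\<forall>t \<ge> 0. region (agent I i) (extended_state (agent I i) (b i) t) \<inter>
                 region (agent I j) (extended_state (agent I j) (b j) t) = {}))"

(* Algorithms are partial functions of the instance data. None stands for every run that
   returns no solution, whether it diverges or stops with a failure report. *)
type_synonym mamp_algorithm = "mamp \<Rightarrow> (real \<times> (nat \<Rightarrow> motion)) option"
type_synonym backward_algorithm = "mamp \<Rightarrow> (nat \<Rightarrow> motion) option"

definition complete_simultaneous :: "mamp_algorithm \<Rightarrow> bool" where
  "complete_simultaneous B \<longleftrightarrow>
     (\<forall>I. mamp_instance I \<longrightarrow> (\<exists>sol. feasible_solution I sol) \<longrightarrow>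
        (\<exists>sol. B I = Some sol \<and> feasible_solution I sol))"

definition complete_backward :: "backward_algorithm \<Rightarrow> bool" where
  "complete_backward A \<longleftrightarrow>
     (\<forall>I. mamp_instance I \<longrightarrow> (\<exists>b. feasible_backward_solution I b) \<longrightarrow>
        (\<exists>b. A (backward I) = Some b \<and> feasible_backward_solution I b))"

definition SA :: "backward_algorithm \<Rightarrow> mamp_algorithm" where
  "SA A I = (case A (backward I) of
       None \<Rightarrow> None
     | Some b \<Rightarrow>
         let tf = Max ((\<lambda>i. duration (b i)) ` {..<num_agents I}) in
         Some (tf, \<lambda>i. \<lparr>duration = tf,
           state = (\<lambda>t. if t \<ge> tf - duration (b i) then state (b i) (tf - t)
                        else start (agent I i)),
           control = (\<lambda>t. if t \<ge> tf - duration (b i) then control (b i) (tf - t)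
                          else 0\<^sub>v (control_dim (agent I i)))\<rparr>))"

lemma reverse_motion_reverse_motion: "reverse_motion (reverse_motion m) = m"
  by (simp add: reverse_motion_def)

(* No information is lost in passing to the backward problem. *)
lemma backward_backward: "backward (backward I) = I"
  by (simp add: backward_def backward_agent_def image_image reverse_motion_reverse_motion)

lemma feasible_primitive_backward_agent:
  assumes p: "feasible_primitive a p"
    and dyn: "\<And>x u. x \<in> carrier_vec (state_dim a) \<Longrightarrow> u \<in> controls a
                \<Longrightarrow> dynamics a x u \<in> carrier_vec (state_dim a)"
  shows "feasible_primitive (backward_agent a) (reverse_motion p)"
proof -
  let ?T = "duration p"
  have "((\<lambda>s. state p (?T - s) $ k) has_real_derivative
          (- dynamics a (state p (?T - t)) (control p (?T - t))) $ k) (at t within {0..?T})"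
    if t: "t \<in> {0..?T}" and k: "k < state_dim a" for t k
  proof -
    let ?D = "dynamics a (state p (?T - t)) (control p (?T - t))"
    have t': "?T - t \<in> {0..?T}" using t by auto
    have im: "(\<lambda>s. ?T - s) ` {0..?T} \<subseteq> {0..?T}" by auto
    have "((\<lambda>s. state p s $ k) has_real_derivative ?D $ k) (at (?T - t) within {0..?T})"
      using p t' k by (auto simp: feasible_primitive_def)
    then have *: "((\<lambda>s. state p s $ k) has_real_derivative ?D $ k)
        (at (?T - t) within (\<lambda>s. ?T - s) ` {0..?T})"
      using im by (rule DERIV_subset)
    have "((\<lambda>s. ?T - s) has_real_derivative - 1) (at t within {0..?T})"
      by (auto intro!: derivative_eq_intros)
    from DERIV_image_chain[OF * this]
    have "((\<lambda>s. state p (?T - s) $ k) has_real_derivative - (?D $ k)) (at t within {0..?T})"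
      by (simp add: o_def)
    moreover have "?D \<in> carrier_vec (state_dim a)"
      using p t' by (intro dyn) (auto simp: feasible_primitive_def)
    ultimately show ?thesis using k by simp
  qed
  then show ?thesis
    using p by (auto simp: feasible_primitive_def backward_agent_def reverse_motion_def)
qed

end

(* Time reversal turns a simultaneous-arrival solution into a backward solution, so the backward
   instance is solvable. Conversely, SA reverses each backward motion and lets agent i first wait
   for tf - t_{f,i} at its start, where it is at rest; this wait merges with the initial wait of
   the reversed motion, so the result is admissible. At time t the agents are where the extended
   backward motions are at time tf - t, so there are no collisions. *)
theory Submission imports Defs
begin

lemma same_motion_sym: "same_motion m m' \<Longrightarrow> same_motion m' m"
  by (simp add: same_motion_def)

lemma same_motion_trans: "same_motion m m' \<Longrightarrow> same_motion m' m'' \<Longrightarrow> same_motion m m''"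
  by (simp add: same_motion_def)

lemma same_motion_reverse_motion:
  "same_motion m m' \<Longrightarrow> same_motion (reverse_motion m) (reverse_motion m')"
  by (auto simp: same_motion_def reverse_motion_def)

lemma same_motion_append_motion:
  "same_motion m m' \<Longrightarrow> 0 \<le> duration n \<Longrightarrow>
     same_motion (append_motion n m) (append_motion n m')"
  by (auto simp: same_motion_def append_motion_def)

lemma duration_nonneg:
  assumes "wait_then_primitives a m" and "\<And>p. p \<in> primitives a \<Longrightarrow> 0 \<le> duration p"
  shows "0 \<le> duration m"
  using assms by (induction) (simp_all add: wait_def append_motion_def)

text \<open>Two consecutive waits fuse into a single wait of length s + \<tau>, which settles the
  base case; each later primitive is carried along by associativity of concatenation.\<close>

lemma wait_then_primitives_prepend_wait:
  assumes "wait_then_primitives a m" and "0 \<le> s"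
    and dur: "\<And>p. p \<in> primitives a \<Longrightarrow> 0 \<le> duration p"
  shows "\<exists>m'. wait_then_primitives a m' \<and> same_motion m' (append_motion (wait a s) m)"
  using assms(1)
proof induction
  case (wait \<tau>)
  then have "wait_then_primitives a (Defs.wait a (s + \<tau>))"
    using \<open>0 \<le> s\<close> by (intro wait_then_primitives.wait) simp
  moreover have "same_motion (Defs.wait a (s + \<tau>)) (append_motion (Defs.wait a s) (Defs.wait a \<tau>))"
    by (simp add: same_motion_def append_motion_def wait_def)
  ultimately show ?case by blast
next
  case (append m p)
  then obtain m' where m': "wait_then_primitives a m'"
    and same: "same_motion m' (append_motion (Defs.wait a s) m)"
    by blast
  have nonneg: "0 \<le> duration m"
    using append.hyps(1) dur by (rule duration_nonneg)
  have dur': "duration m' = s + duration m"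
    using same by (simp add: same_motion_def append_motion_def wait_def)
  have eq: "state m' t = state (append_motion (Defs.wait a s) m) t"
    "control m' t = control (append_motion (Defs.wait a s) m) t"
    if "0 \<le> t" "t \<le> s + duration m" for t
    using same that dur' by (auto simp: same_motion_def)
  \<comment> \<open>By \<open>nonneg\<close> the junction time \<open>s + duration m\<close> is not
    before the end of the wait, so the state there is the final state of \<open>m\<close>.\<close>
  have "state m' (duration m') = state p 0"
    using eq[of "s + duration m"] dur' nonneg \<open>0 \<le> s\<close> append.hyps
    by (simp add: append_motion_def wait_def)
  with m' append.hyps(2) have "wait_then_primitives a (append_motion m' p)"
    by (rule wait_then_primitives.append)
  moreover have "same_motion (append_motion m' p)
      (append_motion (Defs.wait a s) (append_motion m p))"
    using eq dur' nonneg by (auto simp: same_motion_def append_motion_def wait_def algebra_simps)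
  ultimately show ?case by blast
qed

lemma admissible_forward_prepend_wait:
  assumes "admissible_forward a m" and s: "0 \<le> s"
    and dur: "\<And>p. p \<in> primitives a \<Longrightarrow> 0 \<le> duration p"
  shows "admissible_forward a (append_motion (wait a s) m)"
proof -
  obtain m' where m': "wait_then_primitives a m'" "same_motion m m'"
    using assms(1) by (auto simp: admissible_forward_def)
  obtain m'' where m'': "wait_then_primitives a m''"
      "same_motion m'' (append_motion (wait a s) m')"
    using wait_then_primitives_prepend_wait[OF m'(1) s dur] by blast
  have "same_motion (append_motion (wait a s) m) (append_motion (wait a s) m')"
    using m'(2) s by (intro same_motion_append_motion) (simp_all add: wait_def)
  with m'' show ?thesis
    unfolding admissible_forward_def by (blast intro: same_motion_sym same_motion_trans)
qed

lemma admissible_forward_same_motion: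
  "admissible_forward a m \<Longrightarrow> same_motion m' m \<Longrightarrow> admissible_forward a m'"
  unfolding admissible_forward_def by (blast intro: same_motion_trans)

lemma feasible_backward_solution_reverse:
  assumes "feasible_solution I (tf, m)"
  shows "feasible_backward_solution I (\<lambda>i. reverse_motion (m i))"
proof -
  have tf: "0 \<le> tf"
    and m: "duration (m i) = tf" "admissible_forward (agent I i) (m i)"
      "state (m i) 0 = start (agent I i)" "state (m i) tf = goal (agent I i)"
      "\<And>t. t \<in> {0..tf} \<Longrightarrow> state (m i) t \<in> free_space I i"
    if "i < num_agents I" for i
    using assms that by (auto simp: feasible_solution_def)
  have disj: "region (agent I i) (state (m i) t) \<inter> region (agent I j) (state (m j) t) = {}"
    if "i < num_agents I" "j < num_agents I" "i \<noteq> j" "t \<in> {0..tf}" for i j t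
    using assms that by (simp add: feasible_solution_def)
  \<comment> \<open>All agents share the final time \<open>tf\<close>, and resting at
    \<open>start\<close> afterwards repeats the forward state at time 0. Clamping forward time at 0
    therefore covers the extension, and every backward time corresponds to a forward time in
    \<open>{0..tf}\<close>.\<close>
  have ext: "extended_state (agent I i) (reverse_motion (m i)) t = state (m i) (max 0 (tf - t))"
    if "i < num_agents I" for i t
    using m[OF that] by (auto simp: extended_state_def reverse_motion_def max_def)
  have "region (agent I i) (extended_state (agent I i) (reverse_motion (m i)) t) \<inter>
        region (agent I j) (extended_state (agent I j) (reverse_motion (m j)) t) = {}"
    if "i < num_agents I" "j < num_agents I" "i \<noteq> j" "0 \<le> t" for i j t
    using that tf[OF that(1)] by (simp only: ext) (rule disj; auto)
  moreover have "\<exists>m'. admissible_forward (agent I i) m' \<and>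
      same_motion (reverse_motion (m i)) (reverse_motion m')" if "i < num_agents I" for i
    using m[OF that] by (auto simp: same_motion_def)
  ultimately show ?thesis
    using tf m unfolding feasible_backward_solution_def by (auto simp: reverse_motion_def)
qed

text \<open>Both sides give the junction time to the later piece, so they agree as functions on the
  whole real line; the time arguments match because
  \<open>duration (b i) - (t - (tf - duration (b i))) = tf - t\<close>.\<close>

lemma SA_eq_append_motion:
  assumes "A (backward I) = Some b"
    and "tf = Max ((\<lambda>i. duration (b i)) ` {..<num_agents I})"
  shows "SA A I = Some (tf, \<lambda>i.
    append_motion (wait (agent I i) (tf - duration (b i))) (reverse_motion (b i)))"
  using assms(1)
  by (simp add: SA_def Let_def append_motion_def wait_def reverse_motion_def fun_eq_iff
      flip: assms(2))

text \<open>The bound \<open>le\<close> makes every inserted wait last a nonnegative time; that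
  \<open>tf\<close> is the maximum matters only for obtaining this bound.\<close>

lemma feasible_solution_of_backward:
  assumes I: "mamp_instance I" and b: "feasible_backward_solution I b"
    and le: "\<And>i. i < num_agents I \<Longrightarrow> duration (b i) \<le> tf"
  shows "feasible_solution I (tf, \<lambda>i.
    append_motion (wait (agent I i) (tf - duration (b i))) (reverse_motion (b i)))"
    (is "feasible_solution I (tf, ?m)")
proof -
  have bi: "0 \<le> duration (b i)"
      "\<exists>m. admissible_forward (agent I i) m \<and> same_motion (b i) (reverse_motion m)"
      "state (b i) 0 = goal (agent I i)"
      "state (b i) (duration (b i)) = start (agent I i)"
      "\<And>t. t \<in> {0..duration (b i)} \<Longrightarrow> state (b i) t \<in> free_space I i"
    if "i < num_agents I" for i
    using b that by (auto simp: feasible_backward_solution_def)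
  have disj: "region (agent I i) (extended_state (agent I i) (b i) t) \<inter>
      region (agent I j) (extended_state (agent I j) (b j) t) = {}"
    if "i < num_agents I" "j < num_agents I" "i \<noteq> j" "0 \<le> t" for i j t
    using b that by (simp add: feasible_backward_solution_def)
  \<comment> \<open>Some agent exists, and its nonnegative duration lies below
    \<open>tf\<close>.\<close>
  have "0 < num_agents I"
    using I by (simp add: mamp_instance_def)
  then have tf: "0 \<le> tf"
    using bi(1) le by (meson order_trans)
  \<comment> \<open>The wait condition \<open>t < tf - duration (b i)\<close> says exactly that the
    backward time \<open>tf - t\<close> lies past the end of \<open>b i\<close>. Hence all agents
    are read off at one common backward time.\<close>
  have st: "state (?m i) t = extended_state (agent I i) (b i) (tf - t)" for i t
    by (auto simp: append_motion_def wait_def reverse_motion_def extended_state_def)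
  have adm: "admissible_forward (agent I i) (?m i)" if i: "i < num_agents I" for i
  proof (rule admissible_forward_prepend_wait)
    obtain m where "admissible_forward (agent I i) m" "same_motion (b i) (reverse_motion m)"
      using bi(2)[OF i] by blast
    \<comment> \<open>Reversal is an involution, so reversing \<open>b i\<close> gives back
      \<open>m\<close> on its time interval.\<close>
    then show "admissible_forward (agent I i) (reverse_motion (b i))"
      by (metis admissible_forward_same_motion same_motion_reverse_motion
          reverse_motion_reverse_motion)
    show "0 \<le> duration p" if "p \<in> primitives (agent I i)" for p
      using I i that by (fastforce simp: mamp_instance_def Let_def feasible_primitive_def)
  qed (use le[OF i] in simp)
  \<comment> \<open>The start is the end state of the backward motion, so the inserted wait is spent
    in free space.\<close>
  have start: "start (agent I i) \<in> free_space I i" if "i < num_agents I" for i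
    using bi(5)[OF that, of "duration (b i)"] bi(1,4)[OF that] by simp
  have "duration (?m i) = tf \<and> admissible_forward (agent I i) (?m i) \<and>
        state (?m i) 0 = start (agent I i) \<and> state (?m i) tf = goal (agent I i) \<and>
        (\<forall>t \<in> {0..tf}. state (?m i) t \<in> free_space I i)" if i: "i < num_agents I" for i
  proof (intro conjI ballI)
    show "duration (?m i) = tf"
      by (simp add: append_motion_def wait_def reverse_motion_def)
    \<comment> \<open>If \<open>duration (b i) = tf\<close>, the wait is empty and forward time 0 is
      the end of the backward motion; otherwise the agent is waiting.\<close>
    show "state (?m i) 0 = start (agent I i)"
      unfolding st using bi(4)[OF i] le[OF i] by (auto simp: extended_state_def)
    show "state (?m i) tf = goal (agent I i)"
      unfolding st using bi(1,3)[OF i] by (simp add: extended_state_def)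
    show "state (?m i) t \<in> free_space I i" if "t \<in> {0..tf}" for t
      unfolding st using bi(5)[OF i] start[OF i] that by (simp add: extended_state_def)
  qed (rule adm[OF i])
  moreover have "region (agent I i) (state (?m i) t) \<inter> region (agent I j) (state (?m j) t) = {}"
    if "i < num_agents I" "j < num_agents I" "i \<noteq> j" "t \<in> {0..tf}" for i j t
    unfolding st using that by (intro disj) auto
  ultimately show ?thesis
    using tf by (simp add: feasible_solution_def)
qed

theorem theorem1:
  fixes A :: backward_algorithm
  assumes "complete_backward A"
  shows "complete_simultaneous (SA A)"
  unfolding complete_simultaneous_def
proof (intro allI impI)
  fix I assume I: "mamp_instance I" and "\<exists>sol. feasible_solution I sol"
  then have "\<exists>b. feasible_backward_solution I b"
    using feasible_backward_solution_reverse by (metis surj_pair)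
  then obtain b where b: "A (backward I) = Some b" "feasible_backward_solution I b"
    using assms I unfolding complete_backward_def by blast
  \<comment> \<open>The bound on the durations holds because \<open>tf\<close> is the maximum of a
    finite set that contains each of them.\<close>
  show "\<exists>sol. SA A I = Some sol \<and> feasible_solution I sol"
    using SA_eq_append_motion[of A I b, OF b(1) refl] feasible_solution_of_backward[OF I b(2)]
    by simp
qed

end
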